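(* Given any compartmental spreading process (as defined in the context), whose compartment membership probabilities $p_i^{\{c\}}(t)=\Pr(x_i(t)=c)$ therefore evolve by the exact moment dynamics stated in the context, the solutions of the system (over all $i\in V$, $c\in\mathcal{C}$) $$\begin{aligned} \dot{\bar p}_i^{\{c\}}=&\sum_{c'\in\mathcal{E}(c)}\sum_{\tilde c\in\mathcal{A}(c',c)}\sum_{j\in V}\min\{1-\bar p_i^{\{c\}},\,\bar p_j^{\{\tilde c\}}\}\,\beta_{ij}^{\{\tilde c;\,c'\to c\}} -\sum_{c'\in\mathcal{E}(c)}\sum_{\tilde c\in\mathcal{A}(c,c')}\sum_{j\in V}\max\{0,\,\bar p_i^{\{c\}}+\underline p_j^{\{\tilde c\}}-1\}\,\beta_{ij}^{\{\tilde c;\,c\to c'\}}\\ &+\sum_{c'\in\mathcal{I}(c)}\Big[(1-\bar p_i^{\{c\}})\,\delta_i^{\{c'\to c\}}-\bar p_i^{\{c\}}\,\delta_i^{\{c\to c'\}}\Big],\\ \dot{\underline p}_i^{\{c\}}=&\sum_{c'\in\mathcal{E}(c)}\sum_{\tilde c\in\mathcal{A}(c',c)}\sum_{j\in V}\max\{0,\,\underline p_i^{\{c'\}}+\underline p_j^{\{\tilde c\}}-1\}\,\beta_{ij}^{\{\tilde c;\,c'\to c\}} -\sum_{c'\in\mathcal{E}(c)}\sum_{\tilde c\in\mathcal{A}(c,c')}\sum_{j\in V}\min\{\underline p_i^{\{c\}},\,\bar p_j^{\{\tilde c\}}\}\,\beta_{ij}^{\{\tilde c;\,c\to c'\}}\\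 &+\sum_{c'\in\mathcal{I}(c)}\Big[\underline p_i^{\{c'\}}\,\delta_i^{\{c'\to c\}}-\underline p_i^{\{c\}}\,\delta_i^{\{c\to c'\}}\Big] \end{aligned}$$ satisfy $$0\le \underline p_i^{\{c\}}(t)\le p_i^{\{c\}}(t)\le \bar p_i^{\{c\}}(t)\le 1\quad\text{for all } t\ge t_0,$$ for all initial values $\underline p_i^{\{c\}}(t_0)=p_i^{\{c\}}(t_0)=\bar p_i^{\{c\}}(t_0)\in[0,1]$.
   Context: Compartmental spreading process: $V$ is the finite node set of a graph $G=\{V,E\}$ and $\mathcal{C}$ is a finite set of compartments. At each time $t$ every node $i$ is a member of exactly one compartment $x_i(t)\in\mathcal{C}$, and the joint state is a continuous-time Markov process. Each transition type $\{c\to c'\}$ ($c\neq c'$) is external, internal, or not possible. Node $i$ transitions from $c$ to $c'$ via a Poisson process of rate $\lambda_{i\,(t)}^{\{c\to c'\}}$, where - if $\{c\to c'\}$ is external, $\lambda_{i\,(t)}^{\{c\to c'\}}=\sum_{j\in V}\sum_{\tilde c\in\mathcal{A}(c,c')}\mathbf{1}_{\{x_j(t)=\tilde c\}}\beta_{ij}^{\{\tilde c;\,c\to c'\}}$, where $\mathcal{A}(c,c')\subseteq\mathcal{C}$ is the affector set of the transition (the compartments by which the transition is affected); - if $\{c\to c'\}$ is internal, $\lambda_{i\,(t)}^{\{c\to c'\}}=\delta_i^{\{c\to c'\}}$; - if $\{c\to c'\}$ is not possible, $\lambda_{i\,(t)}^{\{c\to c'\}}=0$. The rates satisfy $0\le\beta_{ij}^{\{\tilde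 c;\,c\to c'\}}<\infty$ and $0\le\delta_i^{\{c\to c'\}}<\infty$. $\mathcal{E}(c)$ is the set of compartments $c'$ for which either or both of $\{c\to c'\}$, $\{c'\to c\}$ are external; $\mathcal{I}(c)$ is the set of compartments $c'$ for which either or both of $\{c\to c'\}$, $\{c'\to c\}$ are internal. Convention: $\beta$-terms belonging to a transition that is not external, and $\delta$-terms belonging to a transition that is not internal, are zero. Exact moment dynamics: $$\begin{aligned}\frac{d\,\mathbb{E}[\mathbf{1}_{\{x_i(t)=c\}}]}{dt}=&\ \mathbb{E}\Big[\sum_{c'\in\mathcal{E}(c)}\sum_{\tilde c\in\mathcal{A}(c',c)}\sum_{j\in V}\mathbf{1}_{\{x_i(t)=c'\}}\mathbf{1}_{\{x_j(t)=\tilde c\}}\beta_{ij}^{\{\tilde c;\,c'\to c\}}\Big]-\mathbb{E}\Big[\sum_{c'\in\mathcal{E}(c)}\sum_{\tilde c\in\mathcal{A}(c,c')}\sum_{j\in V}\mathbf{1}_{\{x_i(t)=c\}}\mathbf{1}_{\{x_j(t)=\tilde c\}}\beta_{ij}^{\{\tilde c;\,c\to c'\}}\Big]\\&+\mathbb{E}\Big[\sum_{c'\in\mathcal{I}(c)}\mathbf{1}_{\{x_i(t)=c'\}}\delta_i^{\{c'\to c\}}\Big]-\mathbb{E}\Big[\sum_{c'\in\mathcal{I}(c)}\mathbf{1}_{\{x_i(t)=c\}}\delta_i^{\{c\to c'\}}\Big].\end{aligned}$$ *)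

theory Defs
  imports "HOL-Probability.Probability"
begin

text \<open>
  A continuous-time Markov chain on a finite state space, observed from time \<open>t0\<close> on, given by its
  Markov property and its infinitesimal description: for \<open>x \<noteq> y\<close>, and uniformly in \<open>t\<close>,
  \<open>P(X(t+h) = y | X(t) = x) = q x y * h + o(h)\<close> as \<open>h\<close> tends to \<open>0\<close> from the right.
  The diagonal entries \<open>q x x\<close> are not used. Conditioning is restricted to events of positive
  probability because \<^const>\<open>cond_prob\<close> is \<open>0\<close> on null events.
\<close>

locale continuous_time_markov_chain = prob_space M
  for M :: "'w measure" +
  fixes X :: "real \<Rightarrow> 'w \<Rightarrow> 's::finite" and t0 :: real and q :: "'s \<Rightarrow> 's \<Rightarrow> real"
  assumes measurable_state: "t0 \<le> t \<Longrightarrow> X t \<in> measurable M (count_space UNIV)"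
    and markov_property:
      "\<lbrakk>finite S; S \<subseteq> {t0..<t}; t0 \<le> t; t < u;
        \<P>(\<omega> in M. X t \<omega> = x \<and> (\<forall>s\<in>S. X s \<omega> = f s)) > 0\<rbrakk> \<Longrightarrow>
       \<P>(\<omega> in M. X u \<omega> = y \<bar> X t \<omega> = x \<and> (\<forall>s\<in>S. X s \<omega> = f s)) =
       \<P>(\<omega> in M. X u \<omega> = y \<bar> X t \<omega> = x)"
    and infinitesimal_rates:
      "x \<noteq> y \<Longrightarrow>
       uniform_limit {t. t0 \<le> t \<and> \<P>(\<omega> in M. X t \<omega> = x) > 0}
         (\<lambda>h t. \<P>(\<omega> in M. X (t + h) \<omega> = y \<bar> X t \<omega> = x) / h) (\<lambda>_. q x y) (at_right 0)"

datatype transition_kind = External | Internal | Impossible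

text \<open>
  Nodes and compartments are the elements of finite types \<open>'v\<close> and \<open>'c\<close>. In the rates,
  \<open>\<beta> i j d c c'\<close> is the rate at which node \<open>j\<close>, while in the affector compartment \<open>d\<close>, drives
  node \<open>i\<close> from \<open>c\<close> to \<open>c'\<close>, and \<open>\<delta> i c c'\<close> is the internal rate of node \<open>i\<close> from \<open>c\<close> to \<open>c'\<close>.
  The edges of the underlying graph are only visible through \<open>\<beta>\<close>.
\<close>

definition node_rate ::
    "('c \<Rightarrow> 'c \<Rightarrow> transition_kind) \<Rightarrow> ('c \<Rightarrow> 'c \<Rightarrow> 'c set) \<Rightarrow>
     ('v \<Rightarrow> 'v \<Rightarrow> 'c \<Rightarrow> 'c \<Rightarrow> 'c \<Rightarrow> real) \<Rightarrow> ('v \<Rightarrow> 'c \<Rightarrow> 'c \<Rightarrow> real) \<Rightarrow>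
     ('v::finite \<Rightarrow> 'c::finite) \<Rightarrow> 'v \<Rightarrow> 'c \<Rightarrow> 'c \<Rightarrow> real"
  where "node_rate kind A \<beta> \<delta> x i c c' =
    (case kind c c' of
       External \<Rightarrow> (\<Sum>j\<in>UNIV. \<Sum>d\<in>A c c'. of_bool (x j = d) * \<beta> i j d c c')
     | Internal \<Rightarrow> \<delta> i c c'
     | Impossible \<Rightarrow> 0)"

text \<open>
  Off the diagonal at most one summand is nonzero: a single node changes its compartment at a time.
\<close>

definition joint_rate ::
    "('c \<Rightarrow> 'c \<Rightarrow> transition_kind) \<Rightarrow> ('c \<Rightarrow> 'c \<Rightarrow> 'c set) \<Rightarrow>
     ('v \<Rightarrow> 'v \<Rightarrow> 'c \<Rightarrow> 'c \<Rightarrow> 'c \<Rightarrow> real) \<Rightarrow> ('v \<Rightarrow> 'c \<Rightarrow> 'c \<Rightarrow> real) \<Rightarrow>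
     ('v::finite \<Rightarrow> 'c::finite) \<Rightarrow> ('v \<Rightarrow> 'c) \<Rightarrow> real"
  where "joint_rate kind A \<beta> \<delta> x y =
    (\<Sum>i\<in>UNIV. \<Sum>c'\<in>UNIV - {x i}. if y = x(i := c') then node_rate kind A \<beta> \<delta> x i (x i) c' else 0)"

locale compartmental_spreading_process =
  continuous_time_markov_chain M X t0 "joint_rate kind A \<beta> \<delta>"
  for M :: "'w measure" and X :: "real \<Rightarrow> 'w \<Rightarrow> 'v::finite \<Rightarrow> 'c::finite" and t0 :: real
    and kind :: "'c \<Rightarrow> 'c \<Rightarrow> transition_kind" and A :: "'c \<Rightarrow> 'c \<Rightarrow> 'c set"
    and \<beta> :: "'v \<Rightarrow> 'v \<Rightarrow> 'c \<Rightarrow> 'c \<Rightarrow> 'c \<Rightarrow> real" and \<delta> :: "'v \<Rightarrow> 'c \<Rightarrow> 'c \<Rightarrow> real" +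
  assumes external_rate_nonneg: "c \<noteq> c' \<Longrightarrow> 0 \<le> \<beta> i j d c c'"
    and internal_rate_nonneg: "c \<noteq> c' \<Longrightarrow> 0 \<le> \<delta> i c c'"
    and not_external_zero: "c \<noteq> c' \<Longrightarrow> kind c c' \<noteq> External \<Longrightarrow> \<beta> i j d c c' = 0"
    and not_internal_zero: "c \<noteq> c' \<Longrightarrow> kind c c' \<noteq> Internal \<Longrightarrow> \<delta> i c c' = 0"

definition external_nbrs :: "('c \<Rightarrow> 'c \<Rightarrow> transition_kind) \<Rightarrow> 'c \<Rightarrow> 'c set"
  where "external_nbrs kind c = {c'. c' \<noteq> c \<and> (kind c c' = External \<or> kind c' c = External)}"

definition internal_nbrs :: "('c \<Rightarrow> 'c \<Rightarrow> transition_kind) \<Rightarrow> 'c \<Rightarrow> 'c set"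
  where "internal_nbrs kind c = {c'. c' \<noteq> c \<and> (kind c c' = Internal \<or> kind c' c = Internal)}"

end

theory Submission
  imports Defs
begin

text \<open>
  Uniformity of the infinitesimal rates makes the state probabilities continuous and turns the
  right-hand expansion into a two-sided derivative, which gives the forward equation and, by
  summation over states, the exact moment dynamics. The Frechet bounds
  \<open>max 0 (P E + P F - 1) \<le> P (E \<inter> F) \<le> min (P E) (P F)\<close> then show that whenever one of the defects
  \<open>p - pu\<close>, \<open>pl - p\<close>, \<open>-pl\<close>, \<open>pu - 1\<close> is positive, its derivative is at most a constant times the sum
  of the positive parts of all defects. All defects start nonpositive, so Gronwall's inequality
  for the sum of the squared positive parts keeps them nonpositive.
\<close>

section \<open>Gronwall estimate for positive parts\<close>

text \<open>Squaring removes the kink of \<open>max 0 s\<close>: at \<open>0\<close> the difference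
  quotient is bounded by \<open>\<bar>h\<bar>\<close>, so the one-sided cases glue to a derivative
  everywhere.\<close>

lemma power2_max_0_has_real_derivative:
  "((\<lambda>s::real. (max 0 s)\<^sup>2) has_real_derivative 2 * max 0 s) (at s)"
proof -
  consider "s > 0" | "s < 0" | "s = 0" by linarith
  then show ?thesis
  proof cases
    case 1
    have "((\<lambda>s::real. s\<^sup>2) has_real_derivative 2 * max 0 s) (at s)"
      using 1 by (auto intro!: derivative_eq_intros)
    then show ?thesis
      by (rule DERIV_cong_ev[THEN iffD1, rotated -1])
        (use 1 in \<open>auto intro!: eventually_nhds_in_open[of "{0<..}", THEN eventually_mono]\<close>)
  next
    case 2
    have "((\<lambda>s::real. 0) has_real_derivative 2 * max 0 s) (at s)"
      using 2 by auto
    then show ?thesis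
      by (rule DERIV_cong_ev[THEN iffD1, rotated -1])
        (use 2 in \<open>auto intro!: eventually_nhds_in_open[of "{..<0}", THEN eventually_mono]\<close>)
  next
    case 3
    have "((\<lambda>h::real. (max 0 h)\<^sup>2 / h) \<longlongrightarrow> 0) (at 0)"
    proof (rule Lim_null_comparison)
      show "((\<lambda>h::real. \<bar>h\<bar>) \<longlongrightarrow> 0) (at 0)"
        by (rule tendsto_rabs_zero) (rule tendsto_ident_at)
      show "\<forall>\<^sub>F h::real in at 0. norm ((max 0 h)\<^sup>2 / h) \<le> \<bar>h\<bar>"
        by (rule always_eventually) (auto simp: max_def power2_eq_square)
    qed
    then show ?thesis
      using 3 by (simp add: DERIV_def)
  qed
qed

text \<open>In the derivative of the sum of \<open>(max 0 (z k t))\<^sup>2\<close> the factor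
  \<open>2 * max 0 (z k t)\<close> annihilates every coordinate with \<open>z k t <= 0\<close>, so
  \<open>bound\<close> only has to speak about positive coordinates. Gronwall then applies to this
  sum, which starts at \<open>0\<close>.\<close>

lemma comparison_positive_parts:
  fixes z z' :: "'k \<Rightarrow> real \<Rightarrow> real" and C :: "'k \<Rightarrow> real"
  assumes fin: "finite K"
    and deriv: "\<And>k t. k \<in> K \<Longrightarrow> t0 \<le> t \<Longrightarrow> (z k has_real_derivative z' k t) (at t within {t0..})"
    and init: "\<And>k. k \<in> K \<Longrightarrow> z k t0 \<le> 0"
    and C: "\<And>k. k \<in> K \<Longrightarrow> 0 \<le> C k"
    and bound: "\<And>k t. k \<in> K \<Longrightarrow> t0 \<le> t \<Longrightarrow> 0 < z k t \<Longrightarrow> z' k t \<le> C k * (\<Sum>l\<in>K. max 0 (z l t))"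
    and k: "k \<in> K" and t: "t0 \<le> t"
  shows "z k t \<le> 0"
proof -
  define V where "V = (\<lambda>t. \<Sum>k\<in>K. (max 0 (z k t))\<^sup>2)"
  define V' where "V' = (\<lambda>t. \<Sum>k\<in>K. 2 * max 0 (z k t) * z' k t)"
  \<comment> \<open>The \<open>2\<close> comes from differentiating a square, \<open>sum C K\<close>
    dominates every single \<open>C k\<close>, and \<open>card K\<close> comes from the
    Cauchy-Schwarz bound of a squared sum by the sum of squares.\<close>
  define L where "L = 2 * sum C K * real (card K)"
  have dV: "(V has_real_derivative V' s) (at s within {t0..})" if "t0 \<le> s" for s
    unfolding V_def V'_def
    by (intro DERIV_sum DERIV_chain2[OF power2_max_0_has_real_derivative] deriv that)
  have V'_le: "V' s \<le> L * V s" if s: "t0 \<le> s" for s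
  proof -
    define S where "S = (\<Sum>l\<in>K. max 0 (z l s))"
    have S0: "0 \<le> S" unfolding S_def by (intro sum_nonneg) auto
    have "V' s \<le> (\<Sum>k\<in>K. 2 * max 0 (z k s) * (sum C K * S))"
      unfolding V'_def
    proof (rule sum_mono)
      fix k assume kK: "k \<in> K"
      show "2 * max 0 (z k s) * z' k s \<le> 2 * max 0 (z k s) * (sum C K * S)"
      proof (cases "0 < z k s")
        case True
        have "z' k s \<le> C k * S" using bound[OF kK s True] by (simp add: S_def)
        also have "\<dots> \<le> sum C K * S"
          using member_le_sum[OF kK, of C] C fin S0 by (intro mult_right_mono) auto
        finally show ?thesis using True by (intro mult_left_mono) auto
      qed auto
    qed
    also have "\<dots> = 2 * sum C K * S\<^sup>2"
      by (simp add: S_def power2_eq_square sum_distrib_left sum_distrib_right mult_ac)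
    also have "\<dots> \<le> 2 * sum C K * (real (card K) * V s)"
      using sum_squared_le_sum_of_squares[of "\<lambda>k. max 0 (z k s)" K] fin sum_nonneg[of K C] C
      by (intro mult_left_mono) (auto simp: S_def V_def mult.commute)
    finally show ?thesis by (simp add: L_def mult_ac)
  qed
  \<comment> \<open>Integrating factor: \<open>V' <= L * V\<close> makes \<open>g\<close>
    nonincreasing, and \<open>g t0 = 0\<close>.\<close>
  define g where "g = (\<lambda>t. exp (- L * t) * V t)"
  have dg: "(g has_real_derivative exp (- L * s) * (V' s - L * V s)) (at s within {t0..})"
    if "t0 \<le> s" for s
    unfolding g_def by (auto intro!: derivative_eq_intros dV that simp: algebra_simps)
  have "g t \<le> g t0"
  proof (rule DERIV_nonpos_imp_decreasing_open[OF t])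
    fix s assume s: "t0 < s" "s < t"
    then have "(g has_real_derivative exp (- L * s) * (V' s - L * V s)) (at s)"
      using dg[of s] at_within_interior[of s "{t0..}"] by (simp add: interior_real_atLeast)
    moreover have "exp (- L * s) * (V' s - L * V s) \<le> 0"
      using V'_le[of s] s by (intro mult_nonneg_nonpos) auto
    ultimately show "\<exists>y. (g has_real_derivative y) (at s) \<and> y \<le> 0" by blast
  next
    have "continuous_on {t0..} g"
      using dg by (intro DERIV_continuous_on) auto
    then show "continuous_on {t0..t} g" by (rule continuous_on_subset) auto
  qed
  also have "g t0 = 0"
    using init by (simp add: g_def V_def max_absorb1)
  finally have "V t \<le> 0" by (simp add: g_def mult_le_0_iff)
  moreover have "(max 0 (z k t))\<^sup>2 \<le> V t"
    unfolding V_def using fin k by (intro member_le_sum) auto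
  ultimately have "(max 0 (z k t))\<^sup>2 \<le> 0" by linarith
  then have "max 0 (z k t) = 0" by simp
  then show ?thesis by linarith
qed

section \<open>From uniform right expansions to two-sided derivatives\<close>

text \<open>A bounded \<open>D\<close> turns the expansion into a Lipschitz estimate for small
  steps. Since the step size does not depend on the base point, the estimate can be started at the
  smaller of two times, which also gives continuity from the left.\<close>

lemma uniform_right_expansion_continuous:
  fixes f D :: "real \<Rightarrow> real"
  assumes expansion: "\<And>e. 0 < e \<Longrightarrow>
      \<forall>\<^sub>F h in at_right 0. \<forall>t\<ge>t0. \<bar>f (t + h) - f t - h * D t\<bar> \<le> e * h"
    and bound: "\<And>t. t0 \<le> t \<Longrightarrow> \<bar>D t\<bar> \<le> K"
  shows "continuous_on {t0..} f"
proof -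
  have K: "0 \<le> K" using bound[of t0] by linarith
  \<comment> \<open>Any fixed error works here; \<open>1\<close> yields the Lipschitz constant
    \<open>K + 1\<close>.\<close>
  obtain b where b: "0 < b"
    "\<And>h t. 0 < h \<Longrightarrow> h < b \<Longrightarrow> t0 \<le> t \<Longrightarrow> \<bar>f (t + h) - f t - h * D t\<bar> \<le> 1 * h"
    using expansion[of 1] unfolding eventually_at_right_field by auto
  have step: "\<bar>f (t + h) - f t\<bar> \<le> (K + 1) * h" if "0 < h" "h < b" "t0 \<le> t" for t h
  proof -
    have "\<bar>h * D t\<bar> \<le> K * h"
      using bound[OF \<open>t0 \<le> t\<close>] that by (simp add: abs_mult mult.commute)
    then show ?thesis using b(2)[OF that] unfolding distrib_right by linarith
  qed
  have near: "\<bar>f s - f t\<bar> \<le> (K + 1) * \<bar>s - t\<bar>" if "t0 \<le> s" "t0 \<le> t" "\<bar>s - t\<bar> < b" for s t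
  proof -
    consider "s = t" | "s < t" | "t < s" by linarith
    then show ?thesis
    proof cases
      case 2 then show ?thesis using step[of "t - s" s] that by auto
    next
      case 3 then show ?thesis using step[of "s - t" t] that by auto
    qed auto
  qed
  show ?thesis
    unfolding continuous_on_iff
  proof (intro ballI allI impI)
    fix t e :: real assume t: "t \<in> {t0..}" and e: "0 < e"
    show "\<exists>d>0. \<forall>s\<in>{t0..}. dist s t < d \<longrightarrow> dist (f s) (f t) < e"
    proof (intro exI[of _ "min b (e / (K + 1))"] conjI ballI impI)
      show "0 < min b (e / (K + 1))" using b(1) e K by simp
    next
      fix s assume s: "s \<in> {t0..}" "dist s t < min b (e / (K + 1))"
      then have "(K + 1) * \<bar>s - t\<bar> < e" using K by (simp add: dist_real_def field_simps)
      then show "dist (f s) (f t) < e"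
        using near[of s t] s t by (simp add: dist_real_def)
    qed
  qed
qed

text \<open>A left difference quotient at \<open>t\<close> is a right difference quotient at an
  earlier \<open>s\<close>. Uniformity puts it close to \<open>D s\<close>, and continuity of
  \<open>D\<close> puts \<open>D s\<close> close to \<open>D t\<close>; each takes half of the
  error.\<close>

lemma uniform_right_expansion_has_real_derivative:
  fixes f D :: "real \<Rightarrow> real"
  assumes expansion: "\<And>e. 0 < e \<Longrightarrow>
      \<forall>\<^sub>F h in at_right 0. \<forall>t\<ge>t0. \<bar>f (t + h) - f t - h * D t\<bar> \<le> e * h"
    and cont: "continuous_on {t0..} D" and t: "t0 \<le> t"
  shows "(f has_real_derivative D t) (at t within {t0..})"
proof -
  have "((\<lambda>s. (f s - f t) / (s - t)) \<longlongrightarrow> D t) (at t within {t0..})"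
    unfolding tendsto_iff
  proof (intro allI impI)
    fix e :: real assume e: "0 < e"
    obtain b where b: "0 < b"
      "\<And>h t. 0 < h \<Longrightarrow> h < b \<Longrightarrow> t0 \<le> t \<Longrightarrow> \<bar>f (t + h) - f t - h * D t\<bar> \<le> e / 2 * h"
      using expansion[of "e / 2"] e unfolding eventually_at_right_field by auto
    obtain d where d: "0 < d" "\<And>s. t0 \<le> s \<Longrightarrow> \<bar>s - t\<bar> < d \<Longrightarrow> \<bar>D s - D t\<bar> < e / 2"
      using cont[unfolded continuous_on_iff, rule_format, of t "e / 2"] t e
      by (auto simp: dist_real_def)
    have quotient: "\<bar>(f (s + h) - f s) / h - D s\<bar> \<le> e / 2" if "0 < h" "h < b" "t0 \<le> s" for s h
    proof -
      have "(f (s + h) - f s) / h - D s = (f (s + h) - f s - h * D s) / h"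
        using that by (simp add: field_simps)
      then have "\<bar>(f (s + h) - f s) / h - D s\<bar> = \<bar>f (s + h) - f s - h * D s\<bar> / h"
        using that by simp
      also have "\<dots> \<le> e / 2" using b(2)[OF that] that by (simp add: field_simps)
      finally show ?thesis .
    qed
    have "dist ((f s - f t) / (s - t)) (D t) < e"
      if s: "t0 \<le> s" "s \<noteq> t" "\<bar>s - t\<bar> < min b d" for s
    proof (cases "t < s")
      case True
      then show ?thesis using quotient[of "s - t" t] s t e by (simp add: dist_real_def)
    next
      case False
      then have "\<bar>(f t - f s) / (t - s) - D s\<bar> \<le> e / 2"
        using quotient[of "t - s" s] s by simp
      moreover have "(f t - f s) / (t - s) = (f s - f t) / (s - t)"
        by (metis minus_diff_eq minus_divide_divide)
      moreover have "\<bar>D s - D t\<bar> < e / 2" using d(2) s by simp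
      ultimately show ?thesis unfolding dist_real_def by linarith
    qed
    then show "\<forall>\<^sub>F s in at t within {t0..}. dist ((f s - f t) / (s - t)) (D t) < e"
      unfolding eventually_at using b(1) d(1)
      by (intro exI[of _ "min b d"]) (auto simp: dist_real_def)
  qed
  then show ?thesis by (simp add: has_field_derivative_iff)
qed

section \<open>Forward equation of the finite-state chain\<close>

context continuous_time_markov_chain
begin

definition state_prob :: "'s \<Rightarrow> real \<Rightarrow> real"
  where "state_prob x t = \<P>(\<omega> in M. X t \<omega> = x)"

lemma state_prob_nonneg: "0 \<le> state_prob x t"
  by (simp add: state_prob_def)

lemma state_prob_le_1: "state_prob x t \<le> 1"
  by (simp add: state_prob_def)

lemma sets_state: "t0 \<le> t \<Longrightarrow> {\<omega> \<in> space M. X t \<omega> \<in> S} \<in> events"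
  using measurable_sets[OF measurable_state, of t S]
  by (simp add: vimage_def Int_def conj_commute)

lemma prob_state_pred:
  assumes "t0 \<le> t"
  shows "\<P>(\<omega> in M. P (X t \<omega>)) = (\<Sum>x\<in>UNIV. of_bool (P x) * state_prob x t)"
proof -
  have "\<P>(\<omega> in M. P (X t \<omega>)) = measure M (\<Union>x\<in>Collect P. {\<omega> \<in> space M. X t \<omega> = x})"
    by (rule arg_cong[where f = "measure M"]) auto
  also have "\<dots> = (\<Sum>x\<in>Collect P. state_prob x t)"
    unfolding state_prob_def using sets_state[OF assms, of "{_}"]
    by (subst finite_measure_finite_Union) (auto simp: disjoint_family_on_def image_subset_iff)
  also have "\<dots> = (\<Sum>x\<in>UNIV. of_bool (P x) * state_prob x t)"
    by (rule sum.mono_neutral_cong_left) auto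
  finally show ?thesis .
qed

lemma sum_state_prob: "t0 \<le> t \<Longrightarrow> (\<Sum>x\<in>UNIV. state_prob x t) = 1"
  using prob_state_pred[of t "\<lambda>_. True"] prob_space by simp

definition joint_prob :: "'s \<Rightarrow> 's \<Rightarrow> real \<Rightarrow> real \<Rightarrow> real"
  where "joint_prob x y t u = \<P>(\<omega> in M. X u \<omega> = y \<and> X t \<omega> = x)"

lemma sets_joint:
  "t0 \<le> t \<Longrightarrow> t0 \<le> u \<Longrightarrow> {\<omega> \<in> space M. X u \<omega> = y \<and> X t \<omega> = x} \<in> events"
  using sets.Int[OF sets_state[of t "{x}"] sets_state[of u "{y}"]]
  by (rule back_subst[of "\<lambda>S. S \<in> events"]) auto

lemma sum_joint_prob_left:
  assumes "t0 \<le> t" "t0 \<le> u"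
  shows "(\<Sum>x\<in>UNIV. joint_prob x y t u) = state_prob y u"
proof -
  have "state_prob y u = measure M (\<Union>x\<in>UNIV. {\<omega> \<in> space M. X u \<omega> = y \<and> X t \<omega> = x})"
    unfolding state_prob_def by (rule arg_cong[where f = "measure M"]) auto
  also have "\<dots> = (\<Sum>x\<in>UNIV. joint_prob x y t u)"
    unfolding joint_prob_def using sets_joint[OF assms]
    by (subst finite_measure_finite_Union) (auto simp: disjoint_family_on_def image_subset_iff)
  finally show ?thesis by simp
qed

lemma sum_joint_prob_right:
  assumes "t0 \<le> t" "t0 \<le> u"
  shows "(\<Sum>y\<in>UNIV. joint_prob x y t u) = state_prob x t"
  using sum_joint_prob_left[OF assms(2,1), of x]
  by (simp add: joint_prob_def conj_commute)

text \<open>The conditional expansion is multiplied by \<open>state_prob x t <= 1\<close>, which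
  keeps the error uniform in \<open>t\<close>. At times where state \<open>x\<close> has probability
  \<open>0\<close> both terms on the left vanish, so the restriction to positive probability
  disappears.\<close>

lemma joint_prob_expansion:
  assumes "x \<noteq> y" "0 < e"
  shows "\<forall>\<^sub>F h in at_right 0. \<forall>t\<ge>t0.
    \<bar>joint_prob x y t (t + h) - h * (state_prob x t * q x y)\<bar> \<le> e * h"
proof -
  have "\<forall>\<^sub>F h in at_right 0. \<forall>t\<in>{t. t0 \<le> t \<and> \<P>(\<omega> in M. X t \<omega> = x) > 0}.
      dist (\<P>(\<omega> in M. X (t + h) \<omega> = y \<bar> X t \<omega> = x) / h) (q x y) < e"
    using infinitesimal_rates[OF assms(1)] assms(2) by (auto simp: uniform_limit_iff)
  then show ?thesis
    using eventually_at_right_less[of 0]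
  proof eventually_elim
    case (elim h)
    show ?case
    proof (intro allI impI)
      fix t assume t: "t0 \<le> t"
      show "\<bar>joint_prob x y t (t + h) - h * (state_prob x t * q x y)\<bar> \<le> e * h"
      proof (cases "state_prob x t = 0")
        case True
        have "joint_prob x y t (t + h) \<le> state_prob x t"
          unfolding joint_prob_def state_prob_def
          using sets_state[OF t, of "{x}"] by (intro finite_measure_mono) auto
        then have "joint_prob x y t (t + h) = 0"
          using True by (simp add: joint_prob_def measure_le_0_iff)
        then show ?thesis using True elim(2) assms(2) by simp
      next
        case False
        define r where "r = \<P>(\<omega> in M. X (t + h) \<omega> = y \<bar> X t \<omega> = x)"
        have pos: "0 < state_prob x t" using False state_prob_nonneg[of x t] by simp
        have j: "joint_prob x y t (t + h) = state_prob x t * r"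
          using False by (simp add: r_def cond_prob_def joint_prob_def state_prob_def)
        have "\<bar>r / h - q x y\<bar> < e"
          using elim(1) t pos by (auto simp: r_def state_prob_def dist_real_def)
        then have "h * \<bar>r / h - q x y\<bar> \<le> h * e"
          using elim(2) by (intro mult_left_mono) auto
        moreover have "h * \<bar>r / h - q x y\<bar> = \<bar>r - h * q x y\<bar>"
          using elim(2) by (simp add: abs_mult_pos' right_diff_distrib)
        ultimately have r: "\<bar>r - h * q x y\<bar> \<le> e * h" by (simp add: mult.commute)
        have "\<bar>joint_prob x y t (t + h) - h * (state_prob x t * q x y)\<bar>
            = state_prob x t * \<bar>r - h * q x y\<bar>"
          unfolding j using pos by (simp add: abs_mult_pos' right_diff_distrib mult_ac)
        also have "\<dots> \<le> 1 * \<bar>r - h * q x y\<bar>"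
          by (intro mult_right_mono state_prob_le_1) auto
        finally show ?thesis using r by simp
      qed
    qed
  qed
qed

text \<open>Right-hand side of the forward (master) equation, inflow minus outflow. It is written
  over distinct states because the diagonal of \<open>q\<close> carries no information.\<close>

definition prob_flow :: "'s \<Rightarrow> real \<Rightarrow> real"
  where "prob_flow y t =
    (\<Sum>x\<in>UNIV - {y}. state_prob x t * q x y) - (\<Sum>x\<in>UNIV - {y}. state_prob y t * q y x)"

text \<open>Split the probability of \<open>y\<close> at time \<open>t + h\<close> by the state at
  \<open>t\<close>, and that at time \<open>t\<close> by the state at \<open>t + h\<close>; the
  difference consists of inflow and outflow, which expand separately.\<close>

lemma state_prob_expansion:
  assumes e: "0 < e"
  shows "\<forall>\<^sub>F h in at_right 0. \<forall>t\<ge>t0.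
    \<bar>state_prob y (t + h) - state_prob y t - h * prob_flow y t\<bar> \<le> e * h"
proof -
  define N where "N = real CARD('s)"
  have N: "0 < N" by (simp add: N_def)
  \<comment> \<open>The error is shared among at most \<open>N\<close> inflow and \<open>N\<close>
    outflow terms.\<close>
  define e' where "e' = e / (2 * N)"
  have e': "0 < e'" using e N by (simp add: e'_def)
  have "\<forall>\<^sub>F h in at_right 0. \<forall>x\<in>UNIV - {y}. \<forall>t\<ge>t0.
      \<bar>joint_prob x y t (t + h) - h * (state_prob x t * q x y)\<bar> \<le> e' * h"
    by (intro eventually_ball_finite ballI joint_prob_expansion e') auto
  moreover have "\<forall>\<^sub>F h in at_right 0. \<forall>x\<in>UNIV - {y}. \<forall>t\<ge>t0.
      \<bar>joint_prob y x t (t + h) - h * (state_prob y t * q y x)\<bar> \<le> e' * h"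
    by (intro eventually_ball_finite ballI joint_prob_expansion e') auto
  ultimately show ?thesis
    using eventually_at_right_less[of 0]
  proof eventually_elim
    case (elim h)
    show ?case
    proof (intro allI impI)
      fix t assume t: "t0 \<le> t"
      let ?in = "\<lambda>x. joint_prob x y t (t + h) - h * (state_prob x t * q x y)"
      let ?out = "\<lambda>x. joint_prob y x t (t + h) - h * (state_prob y t * q y x)"
      \<comment> \<open>The term \<open>joint_prob y y t (t + h)\<close> occurs in this
        decomposition and in the next one, and cancels in their difference.\<close>
      have "state_prob y (t + h) = joint_prob y y t (t + h) + (\<Sum>x\<in>UNIV - {y}. joint_prob x y t (t + h))"
        using sum_joint_prob_left[of t "t + h" y] t elim(3)
        by (simp add: sum.remove[of UNIV y])
      moreover have "state_prob y t = joint_prob y y t (t + h) + (\<Sum>x\<in>UNIV - {y}. joint_prob y x t (t + h))"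
        using sum_joint_prob_right[of t "t + h" y] t elim(3)
        by (simp add: sum.remove[of UNIV y])
      ultimately have eq: "state_prob y (t + h) - state_prob y t - h * prob_flow y t
          = sum ?in (UNIV - {y}) - sum ?out (UNIV - {y})"
        by (simp add: prob_flow_def sum_subtractf sum_distrib_left right_diff_distrib)
      have le_N: "real (card (UNIV - {y})) * (e' * h) \<le> N * (e' * h)"
        using e' elim(3) by (intro mult_right_mono) (auto simp: N_def card_mono)
      have "\<bar>sum ?in (UNIV - {y})\<bar> \<le> real (card (UNIV - {y})) * (e' * h)"
        by (rule order.trans[OF sum_abs]) (rule sum_bounded_above, use elim(1) t in blast)
      moreover have "\<bar>sum ?out (UNIV - {y})\<bar> \<le> real (card (UNIV - {y})) * (e' * h)"
        by (rule order.trans[OF sum_abs]) (rule sum_bounded_above, use elim(2) t in blast)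
      moreover have "2 * (N * (e' * h)) = e * h" using N by (simp add: e'_def field_simps)
      ultimately show "\<bar>state_prob y (t + h) - state_prob y t - h * prob_flow y t\<bar> \<le> e * h"
        unfolding eq using le_N by linarith
    qed
  qed
qed

lemma prob_flow_bounded:
  "\<bar>prob_flow y t\<bar> \<le> (\<Sum>x\<in>UNIV - {y}. \<bar>q x y\<bar>) + (\<Sum>x\<in>UNIV - {y}. \<bar>q y x\<bar>)"
proof -
  have "\<bar>state_prob x t * r\<bar> \<le> \<bar>r\<bar>" for x r
    using mult_right_mono[OF state_prob_le_1[of x t] abs_ge_zero[of r]] state_prob_nonneg[of x t]
    by (simp add: abs_mult)
  then show ?thesis
    unfolding prob_flow_def
    by (intro order.trans[OF abs_triangle_ineq4] add_mono order.trans[OF sum_abs] sum_mono)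
qed

text \<open>Bootstrapping: boundedness of the flow makes all state probabilities continuous, hence
  the flow is continuous, hence the uniform expansion upgrades to a derivative.\<close>

theorem kolmogorov_forward:
  assumes "t0 \<le> t"
  shows "(state_prob y has_real_derivative prob_flow y t) (at t within {t0..})"
proof (rule uniform_right_expansion_has_real_derivative[OF state_prob_expansion _ assms])
  have "continuous_on {t0..} (state_prob x)" for x
    by (rule uniform_right_expansion_continuous[OF state_prob_expansion prob_flow_bounded])
  then show "continuous_on {t0..} (prob_flow y)"
    unfolding prob_flow_def[abs_def] by (intro continuous_intros)
qed

text \<open>Dynkin's formula in differential form: exchanging the two state sums moves the flow from
  the distribution onto \<open>f\<close>, where it becomes the generator.\<close>

lemma expectation_has_real_derivative:
  fixes f :: "'s \<Rightarrow> real"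
  assumes "t0 \<le> t"
  shows "((\<lambda>t. \<Sum>x\<in>UNIV. f x * state_prob x t) has_real_derivative
    (\<Sum>x\<in>UNIV. state_prob x t * (\<Sum>y\<in>UNIV - {x}. q x y * (f y - f x)))) (at t within {t0..})"
proof -
  have "((\<lambda>t. \<Sum>x\<in>UNIV. f x * state_prob x t) has_real_derivative
      (\<Sum>x\<in>UNIV. f x * prob_flow x t)) (at t within {t0..})"
    by (intro DERIV_sum DERIV_cmult kolmogorov_forward assms)
  also have "(\<Sum>x\<in>UNIV. f x * prob_flow x t)
      = (\<Sum>x\<in>UNIV. state_prob x t * (\<Sum>y\<in>UNIV - {x}. q x y * (f y - f x)))"
  proof -
    \<comment> \<open>The inner index set depends on the outer index; extending by zero makes the
      sums exchangeable.\<close>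
    have dom: "(\<Sum>x\<in>UNIV - {y}. g x) = (\<Sum>x\<in>UNIV. if x \<noteq> y then g x else 0)"
      for y and g :: "'s \<Rightarrow> real"
      by (rule sum.mono_neutral_cong_left) auto
    have "(\<Sum>y\<in>UNIV. \<Sum>x\<in>UNIV. if x \<noteq> y then f y * (state_prob x t * q x y) else 0)
        = (\<Sum>x\<in>UNIV. \<Sum>y\<in>UNIV. if y \<noteq> x then f y * (state_prob x t * q x y) else 0)"
      by (subst sum.swap) (intro sum.cong refl, auto)
    then show ?thesis
      by (simp add: prob_flow_def right_diff_distrib sum_subtractf sum_distrib_left mult_ac dom
          if_distrib cong: if_cong)
  qed
  finally show ?thesis .
qed

end

section \<open>Sums over single-node moves and weighted sum bounds\<close>

text \<open>\<open>joint_rate\<close> is a sum over single-node moves, each with the one target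
  \<open>x(i := c')\<close>; summing over \<open>y\<close> first lets every move select that
  target.\<close>

lemma sum_joint_rate_generator:
  fixes x :: "'v::finite \<Rightarrow> 'c::finite" and f :: "('v \<Rightarrow> 'c) \<Rightarrow> real"
  shows "(\<Sum>y\<in>UNIV - {x}. joint_rate kind A \<beta> \<delta> x y * (f y - f x)) =
    (\<Sum>i\<in>UNIV. \<Sum>c'\<in>UNIV - {x i}. node_rate kind A \<beta> \<delta> x i (x i) c' * (f (x(i := c')) - f x))"
proof -
  have "(\<Sum>y\<in>UNIV - {x}. joint_rate kind A \<beta> \<delta> x y * (f y - f x))
      = (\<Sum>y\<in>UNIV. joint_rate kind A \<beta> \<delta> x y * (f y - f x))"
    by (rule sum.mono_neutral_left) auto
  also have "\<dots> = (\<Sum>y\<in>UNIV. \<Sum>i\<in>UNIV. \<Sum>c'\<in>UNIV - {x i}.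
      if y = x(i := c') then node_rate kind A \<beta> \<delta> x i (x i) c' * (f y - f x) else 0)"
    unfolding joint_rate_def sum_distrib_right by (intro sum.cong refl) auto
  also have "\<dots> = (\<Sum>i\<in>UNIV. \<Sum>y\<in>UNIV. \<Sum>c'\<in>UNIV - {x i}.
      if y = x(i := c') then node_rate kind A \<beta> \<delta> x i (x i) c' * (f y - f x) else 0)"
    by (rule sum.swap)
  also have "\<dots> = (\<Sum>i\<in>UNIV. \<Sum>c'\<in>UNIV - {x i}. \<Sum>y\<in>UNIV.
      if y = x(i := c') then node_rate kind A \<beta> \<delta> x i (x i) c' * (f y - f x) else 0)"
    by (intro sum.cong refl sum.swap)
  also have "\<dots> = (\<Sum>i\<in>UNIV. \<Sum>c'\<in>UNIV - {x i}.
      node_rate kind A \<beta> \<delta> x i (x i) c' * (f (x(i := c')) - f x))"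
    by (intro sum.cong refl) simp
  finally show ?thesis .
qed

text \<open>A slack \<open>S\<close> allowed in every term costs \<open>S\<close> times the total
  weight. This turns termwise comparisons of gain and loss sums into bounds with a constant built
  from the rates.\<close>

lemma sum3_mult_le:
  fixes g g' b :: "'a \<Rightarrow> 'b \<Rightarrow> 'd \<Rightarrow> real"
  assumes "\<And>x y z. x \<in> A \<Longrightarrow> y \<in> B x \<Longrightarrow> z \<in> D \<Longrightarrow> g x y z \<le> g' x y z + S \<and> 0 \<le> b x y z"
  shows "(\<Sum>x\<in>A. \<Sum>y\<in>B x. \<Sum>z\<in>D. g x y z * b x y z)
    \<le> (\<Sum>x\<in>A. \<Sum>y\<in>B x. \<Sum>z\<in>D. g' x y z * b x y z) + S * (\<Sum>x\<in>A. \<Sum>y\<in>B x. \<Sum>z\<in>D. b x y z)"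
proof -
  have "(\<Sum>x\<in>A. \<Sum>y\<in>B x. \<Sum>z\<in>D. g x y z * b x y z)
      \<le> (\<Sum>x\<in>A. \<Sum>y\<in>B x. \<Sum>z\<in>D. (g' x y z + S) * b x y z)"
    using assms by (intro sum_mono mult_right_mono) auto
  then show ?thesis
    by (simp add: distrib_right sum.distrib sum_distrib_left)
qed

section \<open>Membership probabilities and the exact moment dynamics\<close>

context compartmental_spreading_process
begin

text \<open>Written as the expectation of an indicator over joint states, so that
  \<open>expectation_has_real_derivative\<close> applies directly; agreement with the probability is
  established from \<open>t0\<close> on.\<close>

definition member_prob :: "'v \<Rightarrow> 'c \<Rightarrow> real \<Rightarrow> real"
  where "member_prob i c t = (\<Sum>x\<in>UNIV. of_bool (x i = c) * state_prob x t)"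

definition pair_prob :: "'v \<Rightarrow> 'c \<Rightarrow> 'v \<Rightarrow> 'c \<Rightarrow> real \<Rightarrow> real"
  where "pair_prob i c j d t = (\<Sum>x\<in>UNIV. of_bool (x i = c \<and> x j = d) * state_prob x t)"

lemma prob_eq_member_prob: "t0 \<le> t \<Longrightarrow> \<P>(\<omega> in M. X t \<omega> i = c) = member_prob i c t"
  unfolding member_prob_def by (rule prob_state_pred)

lemma pair_prob_nonneg: "0 \<le> pair_prob i c j d t"
  unfolding pair_prob_def by (intro sum_nonneg mult_nonneg_nonneg state_prob_nonneg) auto

lemma pair_prob_le_left: "pair_prob i c j d t \<le> member_prob i c t"
  unfolding pair_prob_def member_prob_def
  by (intro sum_mono mult_right_mono state_prob_nonneg) auto

lemma pair_prob_le_right: "pair_prob i c j d t \<le> member_prob j d t"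
  unfolding pair_prob_def member_prob_def
  by (intro sum_mono mult_right_mono state_prob_nonneg) auto

text \<open>Lower Frechet bound: the two indicators add up to at most the indicator of both plus
  \<open>1\<close>, and the total mass is \<open>1\<close>.\<close>

lemma pair_prob_ge:
  assumes "t0 \<le> t"
  shows "member_prob i c t + member_prob j d t - 1 \<le> pair_prob i c j d t"
proof -
  have "member_prob i c t + member_prob j d t \<le> (\<Sum>x\<in>UNIV. of_bool (x i = c \<and> x j = d) * state_prob x t + state_prob x t)"
    unfolding member_prob_def sum.distrib[symmetric]
    using state_prob_nonneg[of _ t] by (intro sum_mono) auto
  then show ?thesis
    by (simp add: pair_prob_def sum.distrib sum_state_prob[OF assms])
qed

text \<open>This justifies \<open>1 - pu i c t\<close> in the upper system as a substitute for the
  probability of the source compartment.\<close>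

lemma member_prob_disjoint:
  assumes "t0 \<le> t" "c \<noteq> c'"
  shows "member_prob i c t + member_prob i c' t \<le> 1"
proof -
  have "member_prob i c t + member_prob i c' t \<le> (\<Sum>x\<in>UNIV. state_prob x t)"
    unfolding member_prob_def sum.distrib[symmetric]
    using state_prob_nonneg[of _ t] assms(2) by (intro sum_mono) auto
  then show ?thesis by (simp add: sum_state_prob[OF assms(1)])
qed

text \<open>The convention that rates of the wrong kind are zero replaces the case distinction by a
  plain sum.\<close>

lemma node_rate_eq:
  assumes "c \<noteq> c'"
  shows "node_rate kind A \<beta> \<delta> x i c c' = (\<Sum>d\<in>A c c'. \<Sum>j\<in>UNIV. of_bool (x j = d) * \<beta> i j d c c') + \<delta> i c c'"
proof (cases "kind c c'")
  case External
  then show ?thesis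
    using not_internal_zero[OF assms]
    unfolding node_rate_def by (simp del: sum_of_bool_mult_eq sum_mult_of_bool_eq) (rule sum.swap)
qed (use not_external_zero[OF assms] not_internal_zero[OF assms] in \<open>simp_all add: node_rate_def\<close>)

text \<open>Multiplying the source indicator with the affector indicators inside the rate gives pair
  indicators, so the moment equation does not close in single-node probabilities.\<close>

lemma expected_transition_rate:
  assumes "c \<noteq> c'"
  shows "(\<Sum>x\<in>UNIV. state_prob x t * (of_bool (x i = c) * node_rate kind A \<beta> \<delta> x i c c')) =
    (\<Sum>d\<in>A c c'. \<Sum>j\<in>UNIV. pair_prob i c j d t * \<beta> i j d c c') + member_prob i c t * \<delta> i c c'"
proof -
  have "(\<Sum>x\<in>UNIV. state_prob x t * (of_bool (x i = c) * node_rate kind A \<beta> \<delta> x i c c'))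
      = (\<Sum>x\<in>UNIV. \<Sum>d\<in>A c c'. \<Sum>j\<in>UNIV.
          of_bool (x i = c \<and> x j = d) * state_prob x t * \<beta> i j d c c')
        + member_prob i c t * \<delta> i c c'"
    unfolding node_rate_eq[OF assms] distrib_left sum.distrib member_prob_def sum_distrib_left
      sum_distrib_right
    by (intro arg_cong2[where f = "(+)"] sum.cong refl) (auto simp: of_bool_conj mult_ac)
  also have "(\<Sum>x\<in>UNIV. \<Sum>d\<in>A c c'. \<Sum>j\<in>UNIV.
          of_bool (x i = c \<and> x j = d) * state_prob x t * \<beta> i j d c c')
      = (\<Sum>d\<in>A c c'. \<Sum>x\<in>UNIV. \<Sum>j\<in>UNIV.
          of_bool (x i = c \<and> x j = d) * state_prob x t * \<beta> i j d c c')"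
    by (rule sum.swap)
  also have "\<dots> = (\<Sum>d\<in>A c c'. \<Sum>j\<in>UNIV. \<Sum>x\<in>UNIV.
          of_bool (x i = c \<and> x j = d) * state_prob x t * \<beta> i j d c c')"
    by (intro sum.cong refl sum.swap)
  also have "\<dots> = (\<Sum>d\<in>A c c'. \<Sum>j\<in>UNIV. pair_prob i c j d t * \<beta> i j d c c')"
    unfolding pair_prob_def sum_distrib_right ..
  finally show ?thesis .
qed

text \<open>Only moves of node \<open>i\<close> change the indicator. From \<open>c\<close> every
  move loses it; from another compartment only the move into \<open>c\<close> gains it.\<close>

lemma membership_generator:
  "(\<Sum>y\<in>UNIV - {x}. joint_rate kind A \<beta> \<delta> x y * (of_bool (y i = c) - of_bool (x i = c))) =
   (\<Sum>c'\<in>UNIV - {c}. of_bool (x i = c') * node_rate kind A \<beta> \<delta> x i c' c) -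
   (\<Sum>c'\<in>UNIV - {c}. of_bool (x i = c) * node_rate kind A \<beta> \<delta> x i c c')"
proof -
  let ?r = "node_rate kind A \<beta> \<delta> x"
  have "(\<Sum>y\<in>UNIV - {x}. joint_rate kind A \<beta> \<delta> x y * (of_bool (y i = c) - of_bool (x i = c)))
      = (\<Sum>k\<in>UNIV. \<Sum>c'\<in>UNIV - {x k}. ?r k (x k) c' * (of_bool ((x(k := c')) i = c) - of_bool (x i = c)))"
    by (rule sum_joint_rate_generator)
  also have "\<dots> = (\<Sum>k\<in>{i}. \<Sum>c'\<in>UNIV - {x k}. ?r k (x k) c' * (of_bool ((x(k := c')) i = c) - of_bool (x i = c)))"
    by (rule sum.mono_neutral_right) auto
  also have "\<dots> = (\<Sum>c'\<in>UNIV - {x i}. ?r i (x i) c' * (of_bool (c' = c) - of_bool (x i = c)))"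
    by simp
  also have "\<dots> = (\<Sum>c'\<in>UNIV - {c}. of_bool (x i = c') * ?r i c' c) -
      (\<Sum>c'\<in>UNIV - {c}. of_bool (x i = c) * ?r i c c')"
  proof (cases "x i = c")
    case True
    have "(\<Sum>c'\<in>UNIV - {c}. of_bool (c = c') * ?r i c' c) = 0"
      by (rule sum.neutral) auto
    moreover have "(\<Sum>c'\<in>UNIV - {c}. ?r i c c' * (of_bool (c' = c) - 1)) = (\<Sum>c'\<in>UNIV - {c}. - ?r i c c')"
      by (rule sum.cong) auto
    ultimately show ?thesis using True by (simp add: sum_negf)
  next
    case False
    have "(\<Sum>c'\<in>UNIV - {x i}. ?r i (x i) c' * of_bool (c' = c))
        = (\<Sum>c'\<in>{c}. ?r i (x i) c' * of_bool (c' = c))"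
      using False by (intro sum.mono_neutral_right) auto
    moreover have "(\<Sum>c'\<in>UNIV - {c}. of_bool (x i = c') * ?r i c' c)
        = (\<Sum>c'\<in>{x i}. of_bool (x i = c') * ?r i c' c)"
      using False by (intro sum.mono_neutral_right) auto
    ultimately show ?thesis using False by simp
  qed
  finally show ?thesis .
qed

text \<open>The generator formula for the indicator of \<open>x i = c\<close> first yields sums over
  all \<open>c'\<close> other than \<open>c\<close>; outside the neighbour sets the rates vanish in
  both directions, which shrinks the ranges.\<close>

theorem exact_moment_dynamics:
  assumes "t0 \<le> t"
  shows "(member_prob i c has_real_derivative
      (\<Sum>c'\<in>external_nbrs kind c. \<Sum>d\<in>A c' c. \<Sum>j\<in>UNIV. pair_prob i c' j d t * \<beta> i j d c' c)
    - (\<Sum>c'\<in>external_nbrs kind c. \<Sum>d\<in>A c c'. \<Sum>j\<in>UNIV. pair_prob i c j d t * \<beta> i j d c c')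
    + (\<Sum>c'\<in>internal_nbrs kind c. member_prob i c' t * \<delta> i c' c - member_prob i c t * \<delta> i c c'))
    (at t within {t0..})"
proof -
  let ?gain = "\<lambda>c'. \<Sum>d\<in>A c' c. \<Sum>j\<in>UNIV. pair_prob i c' j d t * \<beta> i j d c' c"
  let ?loss = "\<lambda>c'. \<Sum>d\<in>A c c'. \<Sum>j\<in>UNIV. pair_prob i c j d t * \<beta> i j d c c'"
  let ?r = "\<lambda>x. node_rate kind A \<beta> \<delta> x i"
  have external_zero: "\<beta> i j d c c' = 0" "\<beta> i j d c' c = 0"
    if "c' \<in> UNIV - {c} - external_nbrs kind c" for j d c'
    using that by (auto simp: external_nbrs_def not_external_zero)
  have internal_zero: "\<delta> i c c' = 0" "\<delta> i c' c = 0"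
    if "c' \<in> UNIV - {c} - internal_nbrs kind c" for c'
    using that by (auto simp: internal_nbrs_def not_internal_zero)
  have "(member_prob i c has_real_derivative
      (\<Sum>x\<in>UNIV. state_prob x t *
        (\<Sum>y\<in>UNIV - {x}. joint_rate kind A \<beta> \<delta> x y * (of_bool (y i = c) - of_bool (x i = c)))))
      (at t within {t0..})"
    unfolding member_prob_def[abs_def] by (rule expectation_has_real_derivative[OF assms])
  also have "(\<Sum>x\<in>UNIV. state_prob x t *
        (\<Sum>y\<in>UNIV - {x}. joint_rate kind A \<beta> \<delta> x y * (of_bool (y i = c) - of_bool (x i = c))))
      = (\<Sum>x\<in>UNIV. \<Sum>c'\<in>UNIV - {c}. state_prob x t * (of_bool (x i = c') * ?r x c' c))
        - (\<Sum>x\<in>UNIV. \<Sum>c'\<in>UNIV - {c}. state_prob x t * (of_bool (x i = c) * ?r x c c'))"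
    by (simp only: membership_generator right_diff_distrib[of "state_prob _ t"] sum_subtractf
        sum_distrib_left)
  also have "(\<Sum>x\<in>UNIV. \<Sum>c'\<in>UNIV - {c}. state_prob x t * (of_bool (x i = c') * ?r x c' c))
      = (\<Sum>c'\<in>UNIV - {c}. ?gain c' + member_prob i c' t * \<delta> i c' c)"
    by (subst sum.swap) (auto intro!: sum.cong expected_transition_rate)
  also have "(\<Sum>x\<in>UNIV. \<Sum>c'\<in>UNIV - {c}. state_prob x t * (of_bool (x i = c) * ?r x c c'))
      = (\<Sum>c'\<in>UNIV - {c}. ?loss c' + member_prob i c t * \<delta> i c c')"
    by (subst sum.swap) (auto intro!: sum.cong expected_transition_rate)
  also have "(\<Sum>c'\<in>UNIV - {c}. ?gain c' + member_prob i c' t * \<delta> i c' c)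
        - (\<Sum>c'\<in>UNIV - {c}. ?loss c' + member_prob i c t * \<delta> i c c')
      = (\<Sum>c'\<in>UNIV - {c}. ?gain c') - (\<Sum>c'\<in>UNIV - {c}. ?loss c')
        + (\<Sum>c'\<in>UNIV - {c}. member_prob i c' t * \<delta> i c' c - member_prob i c t * \<delta> i c c')"
    by (simp add: sum.distrib sum_subtractf)
  also have "(\<Sum>c'\<in>UNIV - {c}. ?gain c') = (\<Sum>c'\<in>external_nbrs kind c. ?gain c')"
    by (rule sum.mono_neutral_right) (simp, force simp: external_nbrs_def, simp add: external_zero)
  also have "(\<Sum>c'\<in>UNIV - {c}. ?loss c') = (\<Sum>c'\<in>external_nbrs kind c. ?loss c')"
    by (rule sum.mono_neutral_right) (simp, force simp: external_nbrs_def, simp add: external_zero)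
  also have "(\<Sum>c'\<in>UNIV - {c}. member_prob i c' t * \<delta> i c' c - member_prob i c t * \<delta> i c c')
      = (\<Sum>c'\<in>internal_nbrs kind c. member_prob i c' t * \<delta> i c' c - member_prob i c t * \<delta> i c c')"
    by (rule sum.mono_neutral_right) (simp, force simp: internal_nbrs_def, simp add: internal_zero)
  finally show ?thesis .
qed

end

section \<open>Comparison with the bounding system\<close>

theorem theorem1:
  fixes M :: "'w measure" and X :: "real \<Rightarrow> 'w \<Rightarrow> 'v::finite \<Rightarrow> 'c::finite" and t0 :: real
    and kind :: "'c \<Rightarrow> 'c \<Rightarrow> transition_kind" and A :: "'c \<Rightarrow> 'c \<Rightarrow> 'c set"
    and \<beta> :: "'v \<Rightarrow> 'v \<Rightarrow> 'c \<Rightarrow> 'c \<Rightarrow> 'c \<Rightarrow> real" and \<delta> :: "'v \<Rightarrow> 'c \<Rightarrow> 'c \<Rightarrow> real"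
    and p pl pu :: "'v \<Rightarrow> 'c \<Rightarrow> real \<Rightarrow> real"
  assumes process: "compartmental_spreading_process M X t0 kind A \<beta> \<delta>"
    and p_def: "\<And>i c t. p i c t = \<P>(\<omega> in M. X t \<omega> i = c)"
    and upper: "\<And>i c t. t0 \<le> t \<Longrightarrow>
      (pu i c has_real_derivative
        (\<Sum>c'\<in>external_nbrs kind c. \<Sum>d\<in>A c' c. \<Sum>j\<in>UNIV.
            min (1 - pu i c t) (pu j d t) * \<beta> i j d c' c)
      - (\<Sum>c'\<in>external_nbrs kind c. \<Sum>d\<in>A c c'. \<Sum>j\<in>UNIV.
            max 0 (pu i c t + pl j d t - 1) * \<beta> i j d c c')
      + (\<Sum>c'\<in>internal_nbrs kind c. (1 - pu i c t) * \<delta> i c' c - pu i c t * \<delta> i c c'))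
      (at t within {t0..})"
    and lower: "\<And>i c t. t0 \<le> t \<Longrightarrow>
      (pl i c has_real_derivative
        (\<Sum>c'\<in>external_nbrs kind c. \<Sum>d\<in>A c' c. \<Sum>j\<in>UNIV.
            max 0 (pl i c' t + pl j d t - 1) * \<beta> i j d c' c)
      - (\<Sum>c'\<in>external_nbrs kind c. \<Sum>d\<in>A c c'. \<Sum>j\<in>UNIV.
            min (pl i c t) (pu j d t) * \<beta> i j d c c')
      + (\<Sum>c'\<in>internal_nbrs kind c. pl i c' t * \<delta> i c' c - pl i c t * \<delta> i c c'))
      (at t within {t0..})"
    and initial: "\<And>i c. pl i c t0 = p i c t0 \<and> p i c t0 = pu i c t0"
  shows "\<forall>i c. \<forall>t\<ge>t0. 0 \<le> pl i c t \<and> pl i c t \<le> p i c t \<and> p i c t \<le> pu i c t \<and> pu i c t \<le> 1"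
proof -
  interpret compartmental_spreading_process M X t0 kind A \<beta> \<delta> by (rule process)
  let ?E = "external_nbrs kind" and ?I = "internal_nbrs kind"
  define m where "m = member_prob"
  define J where "J = pair_prob"
  define m' where "m' i c t =
      (\<Sum>c'\<in>?E c. \<Sum>d\<in>A c' c. \<Sum>j\<in>UNIV. J i c' j d t * \<beta> i j d c' c)
    - (\<Sum>c'\<in>?E c. \<Sum>d\<in>A c c'. \<Sum>j\<in>UNIV. J i c j d t * \<beta> i j d c c')
    + (\<Sum>c'\<in>?I c. m i c' t * \<delta> i c' c - m i c t * \<delta> i c c')" for i c t
  define pu' where "pu' i c t =
      (\<Sum>c'\<in>?E c. \<Sum>d\<in>A c' c. \<Sum>j\<in>UNIV. min (1 - pu i c t) (pu j d t) * \<beta> i j d c' c)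
    - (\<Sum>c'\<in>?E c. \<Sum>d\<in>A c c'. \<Sum>j\<in>UNIV. max 0 (pu i c t + pl j d t - 1) * \<beta> i j d c c')
    + (\<Sum>c'\<in>?I c. (1 - pu i c t) * \<delta> i c' c - pu i c t * \<delta> i c c')" for i c t
  define pl' where "pl' i c t =
      (\<Sum>c'\<in>?E c. \<Sum>d\<in>A c' c. \<Sum>j\<in>UNIV. max 0 (pl i c' t + pl j d t - 1) * \<beta> i j d c' c)
    - (\<Sum>c'\<in>?E c. \<Sum>d\<in>A c c'. \<Sum>j\<in>UNIV. min (pl i c t) (pu j d t) * \<beta> i j d c c')
    + (\<Sum>c'\<in>?I c. pl i c' t * \<delta> i c' c - pl i c t * \<delta> i c c')" for i c t
  \<comment> \<open>One finite index type collects all four families of defects: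
    \<open>is_order\<close> selects a comparison with the true probability, otherwise with
    \<open>0\<close> or \<open>1\<close>. They must be treated together because each derivative
    bound involves several of them.\<close>
  define z where "z = (\<lambda>(i, c, is_upper, is_order) t.
      if is_upper then (if is_order then m i c t - pu i c t else pu i c t - 1)
      else (if is_order then pl i c t - m i c t else - pl i c t))"
  define z' where "z' = (\<lambda>(i, c, is_upper, is_order) t.
      if is_upper then (if is_order then m' i c t - pu' i c t else pu' i c t)
      else (if is_order then pl' i c t - m' i c t else - pl' i c t))"
  \<comment> \<open>\<open>G\<close>, \<open>H\<close> and \<open>D\<close> are the total gain, loss
    and internal weights by which a termwise slack is multiplied.\<close>
  define G where "G i c = (\<Sum>c'\<in>?E c. \<Sum>d\<in>A c' c. \<Sum>j\<in>UNIV. \<beta> i j d c' c)" for i c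
  define H where "H i c = (\<Sum>c'\<in>?E c. \<Sum>d\<in>A c c'. \<Sum>j\<in>UNIV. \<beta> i j d c c')" for i c
  define D where "D i c = (\<Sum>c'\<in>?I c. \<delta> i c' c + \<delta> i c c')" for i c
  \<comment> \<open>The factor \<open>2\<close>: in \<open>max 0 (pl i c' t + pl j d t - 1)\<close> both summands may be the same one.\<close>
  define C where "C = (\<lambda>(i, c, is_upper :: bool, is_order :: bool). 2 * (G i c + H i c + D i c))"

  have p_eq: "p i c t = m i c t" if "t0 \<le> t" for i c t
    using that by (simp add: p_def m_def prob_eq_member_prob)
  have \<beta>: "0 \<le> \<beta> i j d c' c" "0 \<le> \<beta> i j d c c'" if "c' \<in> ?E c" for i j d c c'
    using that by (auto simp: external_nbrs_def intro: external_rate_nonneg)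
  have \<delta>: "0 \<le> \<delta> i c' c" "0 \<le> \<delta> i c c'" if "c' \<in> ?I c" for i c c'
    using that by (auto simp: internal_nbrs_def intro: internal_rate_nonneg)
  have nbr_neq: "c' \<noteq> c" if "c' \<in> ?E c \<or> c' \<in> ?I c" for c c'
    using that by (auto simp: external_nbrs_def internal_nbrs_def)
  have internal_le: "(\<Sum>c'\<in>?I c. f c') \<le> (\<Sum>c'\<in>?I c. g c') + S * D i c"
    if "\<And>c'. c' \<in> ?I c \<Longrightarrow> f c' \<le> g c' + S * (\<delta> i c' c + \<delta> i c c')" for f g S i c
    unfolding D_def sum_distrib_left sum.distrib[symmetric] by (intro sum_mono that)

  have dz: "(z k has_real_derivative z' k t) (at t within {t0..})" if t: "t0 \<le> t" for k t
  proof -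
    obtain i c is_upper is_order where k: "k = (i, c, is_upper, is_order)" by (cases k)
    have "(m i c has_real_derivative m' i c t) (at t within {t0..})"
      unfolding m_def m'_def J_def by (rule exact_moment_dynamics[OF t])
    moreover have "(pu i c has_real_derivative pu' i c t) (at t within {t0..})"
      unfolding pu'_def by (rule upper[OF t])
    moreover have "(pl i c has_real_derivative pl' i c t) (at t within {t0..})"
      unfolding pl'_def by (rule lower[OF t])
    ultimately show ?thesis
      unfolding k z_def z'_def by (auto intro!: derivative_eq_intros)
  qed

  have z_init: "z k t0 \<le> 0" for k
  proof -
    obtain i c is_upper is_order where k: "k = (i, c, is_upper, is_order)" by (cases k)
    have "0 \<le> p i c t0" "p i c t0 \<le> 1"
      by (simp_all add: p_def)
    then show ?thesis using initial[of i c] by (simp add: k z_def p_eq)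
  qed

  have C_nonneg: "0 \<le> C k" for k
  proof -
    obtain i c is_upper is_order where k: "k = (i, c, is_upper, is_order)" by (cases k)
    have "0 \<le> G i c" unfolding G_def by (intro sum_nonneg \<beta>(1))
    moreover have "0 \<le> H i c" unfolding H_def by (intro sum_nonneg \<beta>(2))
    moreover have "0 \<le> D i c" unfolding D_def by (intro sum_nonneg add_nonneg_nonneg \<delta>)
    ultimately show ?thesis by (simp add: k C_def)
  qed

  have z'_le: "z' k t \<le> C k * (\<Sum>l\<in>UNIV. max 0 (z l t))" if t: "t0 \<le> t" and pos: "0 < z k t" for k t
  proof -
    define T where "T = (\<Sum>l\<in>UNIV. max 0 (z l t))"
    have T0: "0 \<le> T" unfolding T_def by (intro sum_nonneg) auto
    have zT: "z l t \<le> T" for l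
      unfolding T_def using member_le_sum[of l UNIV "\<lambda>l. max 0 (z l t)"] by simp
    \<comment> \<open>Every inequality to be proved holds at time \<open>t\<close> up to the error
      \<open>T\<close>, for all nodes and compartments.\<close>
    have le_T: "m i c t \<le> pu i c t + T" "pu i c t \<le> 1 + T" "pl i c t \<le> m i c t + T" "- T \<le> pl i c t" for i c
      using zT[of "(i, c, True, True)"] zT[of "(i, c, True, False)"]
        zT[of "(i, c, False, True)"] zT[of "(i, c, False, False)"] by (auto simp: z_def)
    have J: "0 \<le> J i c j d t" "J i c j d t \<le> m i c t" "J i c j d t \<le> m j d t"
      "m i c t + m j d t - 1 \<le> J i c j d t" for i c j d
      unfolding J_def m_def
      by (rule pair_prob_nonneg pair_prob_le_left pair_prob_le_right pair_prob_ge[OF t])+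
    have disj: "m i c' t \<le> 1 - m i c t" if "c' \<noteq> c" for i c c'
      using member_prob_disjoint[OF t that, of i] by (simp add: m_def)
    obtain i c is_upper is_order where k: "k = (i, c, is_upper, is_order)" by (cases k)
    define gain where "gain f = (\<Sum>c'\<in>?E c. \<Sum>d\<in>A c' c. \<Sum>j\<in>UNIV. f c' d j * \<beta> i j d c' c)" for f
    define loss where "loss f = (\<Sum>c'\<in>?E c. \<Sum>d\<in>A c c'. \<Sum>j\<in>UNIV. f c' d j * \<beta> i j d c c')" for f
    have gain_le: "gain f \<le> gain g + (2 * T) * G i c"
      if "\<And>c' d j. c' \<noteq> c \<Longrightarrow> f c' d j \<le> g c' d j + 2 * T" for f g
      unfolding gain_def G_def by (rule sum3_mult_le) (use \<beta> that nbr_neq in blast)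
    have loss_le: "loss f \<le> loss g + (2 * T) * H i c"
      if "\<And>c' d j. c' \<noteq> c \<Longrightarrow> f c' d j \<le> g c' d j + 2 * T" for f g
      unfolding loss_def H_def by (rule sum3_mult_le) (use \<beta> that nbr_neq in blast)
    have m'_eq: "m' i c t = gain (\<lambda>c' d j. J i c' j d t) - loss (\<lambda>c' d j. J i c j d t)
        + (\<Sum>c'\<in>?I c. m i c' t * \<delta> i c' c - m i c t * \<delta> i c c')"
      by (simp add: m'_def gain_def loss_def)
    have pu'_eq: "pu' i c t = gain (\<lambda>c' d j. min (1 - pu i c t) (pu j d t))
        - loss (\<lambda>c' d j. max 0 (pu i c t + pl j d t - 1))
        + (\<Sum>c'\<in>?I c. (1 - pu i c t) * \<delta> i c' c - pu i c t * \<delta> i c c')"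
      by (simp add: pu'_def gain_def loss_def)
    have pl'_eq: "pl' i c t = gain (\<lambda>c' d j. max 0 (pl i c' t + pl j d t - 1))
        - loss (\<lambda>c' d j. min (pl i c t) (pu j d t))
        + (\<Sum>c'\<in>?I c. pl i c' t * \<delta> i c' c - pl i c t * \<delta> i c c')"
      by (simp add: pl'_def gain_def loss_def)
    \<comment> \<open>For the defects against \<open>0\<close> and \<open>1\<close> only one system
      is differentiated, so its terms are compared with zero.\<close>
    have zero: "gain (\<lambda>c' d j. 0) = 0" "loss (\<lambda>c' d j. 0) = 0"
      by (auto simp: gain_def loss_def)
    have C_eq: "C k * T = (2 * T) * G i c + (2 * T) * H i c + (2 * T) * D i c"
      by (simp add: k C_def algebra_simps)
    have mult_le: "a * \<delta> i c' c + b * \<delta> i c c' \<le> (2 * T) * (\<delta> i c' c + \<delta> i c c')"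
      if "c' \<in> ?I c" "a \<le> 2 * T" "b \<le> 2 * T" for a b c'
      unfolding distrib_left using that \<delta> by (intro add_mono mult_right_mono) auto
    consider "is_upper" "is_order" | "is_upper" "\<not> is_order"
      | "\<not> is_upper" "is_order" | "\<not> is_upper" "\<not> is_order" by blast
    then have "z' k t \<le> C k * T"
    proof cases
      case 1
      then have less: "pu i c t < m i c t" using pos by (simp add: k z_def)
      \<comment> \<open>The positive defect has the helpful sign here: \<open>J\<close> is at most
        \<open>m i c' t <= 1 - m i c t < 1 - pu i c t\<close>, so only the affector \<open>j\<close>
        costs an error \<open>T\<close>.\<close>
      have "gain (\<lambda>c' d j. J i c' j d t) \<le> gain (\<lambda>c' d j. min (1 - pu i c t) (pu j d t)) + (2 * T) * G i c"
      proof (rule gain_le)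
        fix c' d j assume "c' \<noteq> c"
        then show "J i c' j d t \<le> min (1 - pu i c t) (pu j d t) + 2 * T"
          using J(2,3)[of i c' j d] disj[of c' c i] le_T(1)[of j d] less T0 by linarith
      qed
      moreover have "loss (\<lambda>c' d j. max 0 (pu i c t + pl j d t - 1)) \<le> loss (\<lambda>c' d j. J i c j d t) + (2 * T) * H i c"
      proof (rule loss_le)
        fix c' d j
        show "max 0 (pu i c t + pl j d t - 1) \<le> J i c j d t + 2 * T"
          using J(1,4)[of i c j d] le_T(3)[of j d] less T0 by linarith
      qed
      moreover have "(\<Sum>c'\<in>?I c. m i c' t * \<delta> i c' c - m i c t * \<delta> i c c')
          \<le> (\<Sum>c'\<in>?I c. (1 - pu i c t) * \<delta> i c' c - pu i c t * \<delta> i c c') + (2 * T) * D i c"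
      proof (rule internal_le)
        fix c' assume c': "c' \<in> ?I c"
        have "(m i c' t - (1 - pu i c t)) * \<delta> i c' c + (pu i c t - m i c t) * \<delta> i c c'
            \<le> (2 * T) * (\<delta> i c' c + \<delta> i c c')"
          using disj[of c' c i] nbr_neq[of c' c] c' less T0 by (intro mult_le) auto
        then show "m i c' t * \<delta> i c' c - m i c t * \<delta> i c c'
            \<le> (1 - pu i c t) * \<delta> i c' c - pu i c t * \<delta> i c c' + (2 * T) * (\<delta> i c' c + \<delta> i c c')"
          by (simp add: algebra_simps)
      qed
      ultimately show ?thesis
        using 1 unfolding C_eq by (simp add: k z'_def m'_eq pu'_eq)
    next
      case 2
      then have less: "1 < pu i c t" using pos by (simp add: k z_def)
      \<comment> \<open>Above \<open>1\<close> the entry \<open>1 - pu i c t\<close> is negative, so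
        the minimum cannot push \<open>pu\<close> further up.\<close>
      have "gain (\<lambda>c' d j. min (1 - pu i c t) (pu j d t)) \<le> gain (\<lambda>c' d j. 0) + (2 * T) * G i c"
        by (rule gain_le) (use less T0 in linarith)
      moreover have "loss (\<lambda>c' d j. 0) \<le> loss (\<lambda>c' d j. max 0 (pu i c t + pl j d t - 1)) + (2 * T) * H i c"
        by (rule loss_le) (use T0 in linarith)
      moreover have "(\<Sum>c'\<in>?I c. (1 - pu i c t) * \<delta> i c' c - pu i c t * \<delta> i c c')
          \<le> (\<Sum>c'\<in>?I c. 0) + (2 * T) * D i c"
      proof (rule internal_le)
        fix c' assume c': "c' \<in> ?I c"
        have "(1 - pu i c t) * \<delta> i c' c + (- pu i c t) * \<delta> i c c' \<le> (2 * T) * (\<delta> i c' c + \<delta> i c c')"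
          using c' less T0 by (intro mult_le) auto
        then show "(1 - pu i c t) * \<delta> i c' c - pu i c t * \<delta> i c c' \<le> 0 + (2 * T) * (\<delta> i c' c + \<delta> i c c')"
          by simp
      qed
      ultimately show ?thesis
        using 2 unfolding C_eq by (simp add: k z'_def pu'_eq zero)
    next
      case 3
      then have less: "m i c t < pl i c t" using pos by (simp add: k z_def)
      \<comment> \<open>The sign of the defect at \<open>c\<close> says nothing about
        \<open>c'\<close>, so both lower bounds are replaced at cost \<open>T\<close> each before
        the lower Frechet bound is used.\<close>
      have "gain (\<lambda>c' d j. max 0 (pl i c' t + pl j d t - 1)) \<le> gain (\<lambda>c' d j. J i c' j d t) + (2 * T) * G i c"
      proof (rule gain_le)
        fix c' d j
        show "max 0 (pl i c' t + pl j d t - 1) \<le> J i c' j d t + 2 * T"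
          using J(1,4)[of i c' j d] le_T(3)[of j d] le_T(3)[of i c'] T0 by linarith
      qed
      moreover have "loss (\<lambda>c' d j. J i c j d t) \<le> loss (\<lambda>c' d j. min (pl i c t) (pu j d t)) + (2 * T) * H i c"
      proof (rule loss_le)
        fix c' d j
        show "J i c j d t \<le> min (pl i c t) (pu j d t) + 2 * T"
          using J(2,3)[of i c j d] le_T(1)[of j d] less T0 by linarith
      qed
      moreover have "(\<Sum>c'\<in>?I c. pl i c' t * \<delta> i c' c - pl i c t * \<delta> i c c')
          \<le> (\<Sum>c'\<in>?I c. m i c' t * \<delta> i c' c - m i c t * \<delta> i c c') + (2 * T) * D i c"
      proof (rule internal_le)
        fix c' assume c': "c' \<in> ?I c"
        have "(pl i c' t - m i c' t) * \<delta> i c' c + (m i c t - pl i c t) * \<delta> i c c'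
            \<le> (2 * T) * (\<delta> i c' c + \<delta> i c c')"
          using c' less T0 le_T(3)[of i c'] by (intro mult_le) auto
        then show "pl i c' t * \<delta> i c' c - pl i c t * \<delta> i c c'
            \<le> m i c' t * \<delta> i c' c - m i c t * \<delta> i c c' + (2 * T) * (\<delta> i c' c + \<delta> i c c')"
          by (simp add: algebra_simps)
      qed
      ultimately show ?thesis
        using 3 unfolding C_eq by (simp add: k z'_def m'_eq pl'_eq)
    next
      case 4
      then have less: "pl i c t < 0" using pos by (simp add: k z_def)
      have "gain (\<lambda>c' d j. 0) \<le> gain (\<lambda>c' d j. max 0 (pl i c' t + pl j d t - 1)) + (2 * T) * G i c"
        by (rule gain_le) (use T0 in linarith)
      \<comment> \<open>With \<open>pl i c t < 0\<close> the minimum is negative, so the loss term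
        pushes \<open>pl\<close> back up.\<close>
      moreover have "loss (\<lambda>c' d j. min (pl i c t) (pu j d t)) \<le> loss (\<lambda>c' d j. 0) + (2 * T) * H i c"
        by (rule loss_le) (use less T0 in linarith)
      moreover have "(\<Sum>c'\<in>?I c. 0)
          \<le> (\<Sum>c'\<in>?I c. pl i c' t * \<delta> i c' c - pl i c t * \<delta> i c c') + (2 * T) * D i c"
      proof (rule internal_le)
        fix c' assume c': "c' \<in> ?I c"
        \<comment> \<open>Internal inflow from \<open>c'\<close> may be negative, but only by the
          defect of \<open>pl i c'\<close>, which \<open>T\<close> contains.\<close>
        have "(- pl i c' t) * \<delta> i c' c + pl i c t * \<delta> i c c' \<le> (2 * T) * (\<delta> i c' c + \<delta> i c c')"
          using c' less T0 le_T(4)[of i c'] by (intro mult_le) auto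
        then show "0 \<le> pl i c' t * \<delta> i c' c - pl i c t * \<delta> i c c' + (2 * T) * (\<delta> i c' c + \<delta> i c c')"
          by simp
      qed
      ultimately show ?thesis
        using 4 unfolding C_eq by (simp add: k z'_def pl'_eq zero)
    qed
    then show ?thesis by (simp add: T_def)
  qed

  have z_le: "z k t \<le> 0" if "t0 \<le> t" for k t
    by (rule comparison_positive_parts[of UNIV t0 z z' C]) (auto intro: dz z_init C_nonneg z'_le that)
  show ?thesis
  proof (intro allI impI)
    fix i c t assume t: "t0 \<le> t"
    show "0 \<le> pl i c t \<and> pl i c t \<le> p i c t \<and> p i c t \<le> pu i c t \<and> pu i c t \<le> 1"
      using z_le[OF t, of "(i, c, True, True)"] z_le[OF t, of "(i, c, True, False)"]
        z_le[OF t, of "(i, c, False, True)"] z_le[OF t, of "(i, c, False, False)"]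
      by (simp add: z_def p_eq[OF t])
  qed
qed

end
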